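(* Let $I$ be a right ideal in $\mathbb{H}[q_1,\ldots,q_n]$. Then $\mathcal{V}(I)$ is a slice algebraic set in $\mathbb{H}^n$.
   Context: $\mathbb{H}$ is the skew field of quaternions. A slice regular polynomial in $n$ variables is a function $P:\mathbb{H}^n\to\mathbb{H}$ of the form $P(q_1,\ldots,q_n)=\sum_{\ell} q_1^{\ell_1}\cdots q_n^{\ell_n}a_{\ell_1,\ldots,\ell_n}$ (finite sum over multi-indices, variables in this fixed order, coefficients in $\mathbb{H}$ on the right). $\mathbb{H}[q_1,\ldots,q_n]$ is the set of these; it is a (non-commutative) ring under $+$ and the $*$-product, the biadditive extension of $(q_1^{\ell_1}\cdots q_n^{\ell_n}a)*(q_1^{m_1}\cdots q_n^{m_n}b)=q_1^{\ell_1+m_1}\cdots q_n^{\ell_n+m_n}ab$. Right ideals are taken with respect to this ring structure. For a right ideal $I$, $\mathcal{V}(I)\subseteq\mathbb{H}^n$ is the set of common zeros (under pointwise evaluation) of all $P\in I$. Let $\mathbb{S}=\{q\in\mathbb{H}: q^2=-1\}$; for $K\in\mathbb{S}$, $\mathbb{C}_K=\mathbb{R}+\mathbb{R}K$ is identified with the complex plane. A subset $V\subseteq\mathbb{H}^n$ is called slice algebraic if for any $K\in\mathbb{S}$, $V\cap\mathbb{C}_K^n$ is a complex algebraic subset of $\mathbb{C}_K^n$ (the common zero set of a family of complex polynomials in $n$ variables over $\mathbb{C}_K$). *)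

theory Defs
  imports "HOL-Analysis.Analysis" "HOL-Library.Poly_Mapping"
begin

datatype quat = Quat (Re0: real) (Im1: real) (Im2: real) (Im3: real)

lemma quat_eq_iff:
  "p = q \<longleftrightarrow> Re0 p = Re0 q \<and> Im1 p = Im1 q \<and> Im2 p = Im2 q \<and> Im3 p = Im3 q"
  by (cases p; cases q) simp

instantiation quat :: real_algebra_1
begin

definition zero_quat :: quat where "0 = Quat 0 0 0 0"

definition one_quat :: quat where "1 = Quat 1 0 0 0"

definition plus_quat :: "quat \<Rightarrow> quat \<Rightarrow> quat" where
  "p + q = Quat (Re0 p + Re0 q) (Im1 p + Im1 q) (Im2 p + Im2 q) (Im3 p + Im3 q)"

definition uminus_quat :: "quat \<Rightarrow> quat" where
  "- p = Quat (- Re0 p) (- Im1 p) (- Im2 p) (- Im3 p)"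

definition minus_quat :: "quat \<Rightarrow> quat \<Rightarrow> quat" where
  "p - q = Quat (Re0 p - Re0 q) (Im1 p - Im1 q) (Im2 p - Im2 q) (Im3 p - Im3 q)"

definition scaleR_quat :: "real \<Rightarrow> quat \<Rightarrow> quat" where
  "r *\<^sub>R p = Quat (r * Re0 p) (r * Im1 p) (r * Im2 p) (r * Im3 p)"

definition times_quat :: "quat \<Rightarrow> quat \<Rightarrow> quat" where
  "p * q = Quat
     (Re0 p * Re0 q - Im1 p * Im1 q - Im2 p * Im2 q - Im3 p * Im3 q)
     (Re0 p * Im1 q + Im1 p * Re0 q + Im2 p * Im3 q - Im3 p * Im2 q)
     (Re0 p * Im2 q - Im1 p * Im3 q + Im2 p * Re0 q + Im3 p * Im1 q)
     (Re0 p * Im3 q + Im1 p * Im2 q - Im2 p * Im1 q + Im3 p * Re0 q)"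

lemmas quat_op_defs = quat_eq_iff zero_quat_def one_quat_def plus_quat_def uminus_quat_def
  minus_quat_def scaleR_quat_def times_quat_def

instance
  by intro_classes (simp_all add: quat_op_defs algebra_simps)

end

instantiation quat :: division_ring
begin

definition inverse_quat :: "quat \<Rightarrow> quat" where
  "inverse p = (1 / ((Re0 p)\<^sup>2 + (Im1 p)\<^sup>2 + (Im2 p)\<^sup>2 + (Im3 p)\<^sup>2)) *\<^sub>R
     Quat (Re0 p) (- Im1 p) (- Im2 p) (- Im3 p)"

definition "p div q = p * inverse q" for p q :: quat

instance
proof
  fix p q :: quat
  let ?n = "(Re0 p)\<^sup>2 + (Im1 p)\<^sup>2 + (Im2 p)\<^sup>2 + (Im3 p)\<^sup>2"
  let ?c = "Quat (Re0 p) (- Im1 p) (- Im2 p) (- Im3 p)"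
  have c: "?c * p = ?n *\<^sub>R 1" "p * ?c = ?n *\<^sub>R 1"
    by (simp_all add: quat_op_defs algebra_simps power2_eq_square)
  show "inverse p * p = 1" "p * inverse p = 1" if "p \<noteq> 0"
  proof -
    have "?n \<noteq> 0"
      using that by (simp add: zero_quat_def quat_eq_iff add_nonneg_eq_0_iff)
    then show "inverse p * p = 1" "p * inverse p = 1"
      unfolding inverse_quat_def mult_scaleR_left mult_scaleR_right c by simp_all
  qed
  show "p div q = p * inverse q"
    by (rule divide_quat_def)
  show "inverse (0::quat) = 0"
    by (simp add: inverse_quat_def zero_quat_def)
qed

end

text \<open>
  The variables are indexed by a finite linearly ordered type \<open>'n\<close> playing the role of
  \<open>{1..n}\<close>. A polynomial is given by its finitely supported family of coefficients; the
  multiplication of \<^typ>\<open>(nat ^ 'n) \<Rightarrow>\<^sub>0 'a\<close> is convolution, which multiplies coefficients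
  in order and lets the variables commute with everything, i.e. the \<open>*\<close>-product
  (see \<open>mult_single\<close>). It differs from the pointwise product of the associated functions.
\<close>

type_synonym ('a, 'n) ord_poly = "(nat ^ 'n) \<Rightarrow>\<^sub>0 'a"

definition ord_monom :: "nat ^ 'n::{finite,linorder} \<Rightarrow> 'a ^ 'n::_ \<Rightarrow> 'a::monoid_mult"
  where "ord_monom l q =
    prod_list (map (\<lambda>i. (q $ i) ^ (l $ i)) (sorted_list_of_set (UNIV :: 'n set)))"

definition ord_eval :: "('a::semiring_1, 'n::{finite,linorder}) ord_poly \<Rightarrow> 'a ^ 'n::_ \<Rightarrow> 'a"
  where "ord_eval P q = (\<Sum>l\<in>Poly_Mapping.keys P. ord_monom l q * Poly_Mapping.lookup P l)"

definition right_ideal :: "'a::ring_1 set \<Rightarrow> bool"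
  where "right_ideal I \<longleftrightarrow>
    0 \<in> I \<and> (\<forall>a\<in>I. \<forall>b\<in>I. a + b \<in> I) \<and> (\<forall>a\<in>I. - a \<in> I) \<and> (\<forall>a\<in>I. \<forall>r. a * r \<in> I)"

definition zero_locus :: "('a::semiring_1, 'n::{finite,linorder}) ord_poly set \<Rightarrow> ('a ^ 'n::_) set"
  where "zero_locus F = {q. \<forall>P\<in>F. ord_eval P q = 0}"

definition imag_units :: "quat set"
  where "imag_units = {q. q\<^sup>2 = -1}"

definition slice_embed :: "quat \<Rightarrow> complex \<Rightarrow> quat"
  where "slice_embed K z = of_real (Re z) + of_real (Im z) * K"

definition slice_plane :: "quat \<Rightarrow> quat set"
  where "slice_plane K = range (slice_embed K)"

definition complex_algebraic :: "(complex ^ 'n::{finite,linorder}) set \<Rightarrow> bool"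
  where "complex_algebraic Z \<longleftrightarrow> (\<exists>F :: (complex, 'n) ord_poly set. Z = zero_locus F)"

definition slice_algebraic :: "(quat ^ 'n::{finite,linorder}) set \<Rightarrow> bool"
  where "slice_algebraic V \<longleftrightarrow>
    (\<forall>K\<in>imag_units. \<exists>Z. complex_algebraic Z \<and>
       V \<inter> {q. \<forall>i. q $ i \<in> slice_plane K} = (\<lambda>z. \<chi> i. slice_embed K (z $ i)) ` Z)"

text \<open>
  Over the quaternions a polynomial is determined by the function it induces, so working with
  coefficient families is the same as working with slice regular polynomial functions.
\<close>

lemma ord_monom_of_real:
  "ord_monom l (\<chi> i. (of_real (x $ i) :: 'a::real_algebra_1)) = of_real (ord_monom l x)"
proof -
  have "prod_list (map (\<lambda>i. (of_real (x $ i) :: 'a) ^ (l $ i)) is)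
      = of_real (prod_list (map (\<lambda>i. (x $ i) ^ (l $ i)) is))" for "is"
    by (induction "is") simp_all
  then show ?thesis
    by (simp add: ord_monom_def)
qed

lemma ord_monom_commutative:
  fixes q :: "'a::comm_monoid_mult ^ 'n::{finite,linorder}"
  shows "ord_monom l q = (\<Prod>i\<in>UNIV. (q $ i) ^ (l $ i))"
  unfolding ord_monom_def
  by (metis distinct_sorted_list_of_set finite_class.finite_UNIV prod.distinct_set_conv_list
      set_sorted_list_of_set)

lemma ord_monom_independent:
  fixes a :: "nat ^ 'n::{finite,linorder} \<Rightarrow> 'b::real_vector"
  assumes "finite S" and "\<And>x. (\<Sum>l\<in>S. ord_monom l x *\<^sub>R a l) = 0"
  shows "\<forall>l\<in>S. a l = 0"
  using assms
proof (induction S arbitrary: a rule: finite_induct)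
  case empty
  then show ?case by simp
next
  case (insert m S)
  have mult: "ord_monom l (\<chi> i. x $ i * y $ i) = ord_monom l x * ord_monom l y"
    for l :: "nat ^ 'n::_" and x y :: "real ^ 'n::_"
    by (simp add: ord_monom_commutative power_mult_distrib prod.distrib)
  have zero: "(ord_monom l y - ord_monom m y) *\<^sub>R a l = 0" if "l \<in> S" for l and y :: "real ^ 'n::_"
  proof -
    have "(\<Sum>l\<in>S. ord_monom l x *\<^sub>R ((ord_monom l y - ord_monom m y) *\<^sub>R a l)) = 0" for x
    proof -
      have "(\<Sum>l\<in>S. ord_monom l x *\<^sub>R ((ord_monom l y - ord_monom m y) *\<^sub>R a l))
          = (\<Sum>l\<in>insert m S. ord_monom l x *\<^sub>R ((ord_monom l y - ord_monom m y) *\<^sub>R a l))"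
        using insert.hyps by simp
      also have "\<dots> = (\<Sum>l\<in>insert m S. ord_monom l (\<chi> i. x $ i * y $ i) *\<^sub>R a l)
          - ord_monom m y *\<^sub>R (\<Sum>l\<in>insert m S. ord_monom l x *\<^sub>R a l)"
        unfolding mult scaleR_sum_right sum_subtractf[symmetric]
        by (intro sum.cong refl) (simp add: algebra_simps)
      also have "\<dots> = 0"
        by (simp only: insert.prems) simp
      finally show ?thesis .
    qed
    from insert.IH[OF this] that show ?thesis by blast
  qed
  have aS: "a l = 0" if "l \<in> S" for l
  proof -
    have "l \<noteq> m" using that insert.hyps by blast
    then obtain j where j: "l $ j \<noteq> m $ j" by (auto simp: vec_eq_iff)
    define y :: "real ^ 'n::_" where "y = (\<chi> i. if i = j then 2 else 1)"
    have y: "ord_monom k y = 2 ^ (k $ j)" for k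
    proof -
      have "ord_monom k y = (\<Prod>i\<in>UNIV. if i = j then 2 ^ (k $ i) else 1)"
        unfolding ord_monom_commutative by (intro prod.cong) (auto simp: y_def)
      then show ?thesis by simp
    qed
    have "ord_monom l y \<noteq> ord_monom m y"
      using j by (simp add: y)
    then show ?thesis using zero[OF that, of y] by simp
  qed
  moreover have "ord_monom m (\<chi> i. (1 :: real)) = 1"
    by (simp add: ord_monom_commutative)
  then have "a m = 0"
    using insert.prems[of "\<chi> i. 1"] insert.hyps aS by simp
  ultimately show ?case by blast
qed

lemma ord_eval_inject:
  fixes P Q :: "('a::real_algebra_1, 'n::{finite,linorder}) ord_poly"
  shows "ord_eval P = ord_eval Q \<longleftrightarrow> P = Q"
proof
  assume eq: "ord_eval P = ord_eval Q"
  let ?S = "Poly_Mapping.keys P \<union> Poly_Mapping.keys Q"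
  have ev: "ord_eval R (\<chi> i. of_real (x $ i))
      = (\<Sum>l\<in>?S. ord_monom l x *\<^sub>R Poly_Mapping.lookup R l)"
    if "Poly_Mapping.keys R \<subseteq> ?S" for R :: "('a, 'n) ord_poly" and x
    unfolding ord_eval_def ord_monom_of_real scaleR_conv_of_real[symmetric]
    using that by (intro sum.mono_neutral_cong_left)
      (auto simp: in_keys_iff scaleR_conv_of_real)
  have "(\<Sum>l\<in>?S. ord_monom l x *\<^sub>R (Poly_Mapping.lookup P l - Poly_Mapping.lookup Q l)) = 0" for x
    using ev[of P x] ev[of Q x] eq by (simp add: algebra_simps sum_subtractf)
  from ord_monom_independent[OF _ this]
  have "\<forall>l\<in>?S. Poly_Mapping.lookup P l - Poly_Mapping.lookup Q l = 0" by simp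
  then show "P = Q"
    by (intro poly_mapping_eqI) (metis UnI1 UnI2 eq_iff_diff_eq_0 in_keys_iff)
qed simp

end

theory Submission
  imports Defs
begin

text \<open>
  A quaternion \<open>x\<close> vanishes iff \<open>\<phi> (x * w) = 0\<close> for all \<open>w\<close>, where \<open>\<phi>\<close> is the projection onto
  \<open>\<complex>\<^sub>K\<close>. As \<open>\<phi>\<close> is left \<open>\<complex>\<^sub>K\<close>-linear, \<open>z \<mapsto> \<phi> (P z * w)\<close> is on \<open>\<complex>\<^sub>K\<^sup>n\<close> the complex polynomial
  with coefficients \<open>\<phi> (a\<^sub>l * w)\<close>.
\<close>

text \<open>For K in \<open>imag_units\<close>, K is a unit vector with real part 0, so
  \<open>- Re0 (K * x)\<close> is the coordinate of x along K. Values lie in \<open>complex\<close>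
  so that they can serve as coefficients.\<close>

definition slice_proj :: "quat \<Rightarrow> quat \<Rightarrow> complex"
  where "slice_proj K x = Complex (Re0 x) (- Re0 (K * x))"

lemma Re0_simps [simp]:
  "Re0 0 = 0" "Re0 1 = 1" "Re0 (x + y) = Re0 x + Re0 y" "Re0 (- x) = - Re0 x"
  "Re0 (r *\<^sub>R x) = r * Re0 x"
  by (simp_all add: quat_op_defs)

lemma slice_proj_0 [simp]: "slice_proj K 0 = 0"
  by (simp add: slice_proj_def complex_eq_iff)

lemma slice_proj_add: "slice_proj K (x + y) = slice_proj K x + slice_proj K y"
  by (simp add: slice_proj_def complex_eq_iff distrib_left)

lemma slice_proj_scaleR: "slice_proj K (r *\<^sub>R x) = r *\<^sub>R slice_proj K x"
  by (simp add: slice_proj_def complex_eq_iff)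

lemma slice_proj_sum: "slice_proj K (sum f A) = (\<Sum>i\<in>A. slice_proj K (f i))"
  by (induction A rule: infinite_finite_induct) (simp_all add: slice_proj_add)

lemma slice_embed_mult_left: "slice_embed K z * x = Re z *\<^sub>R x + Im z *\<^sub>R (K * x)"
  by (simp add: slice_embed_def distrib_right scaleR_conv_of_real mult.assoc)

lemma imag_units_mult_mult:
  assumes "K \<in> imag_units"
  shows "K * (K * x) = - x"
  using assms by (simp add: imag_units_def power2_eq_square flip: mult.assoc)

text \<open>By real linearity only left multiplication by K matters; it acts on the two coordinates
  as \<open>\<i>\<close> because \<open>K * (K * x) = - x\<close>.\<close>

lemma slice_proj_embed_mult:
  assumes "K \<in> imag_units"
  shows "slice_proj K (slice_embed K z * x) = z * slice_proj K x"
proof -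
  have "slice_proj K (K * x) = \<i> * slice_proj K x"
    by (simp add: slice_proj_def complex_eq_iff imag_units_mult_mult[OF assms])
  then show ?thesis
    by (simp add: slice_embed_mult_left slice_proj_add slice_proj_scaleR complex_eq_iff)
qed

text \<open>A single projection has a kernel. The factor w removes it: for nonzero x, taking w as
  \<open>inverse x\<close> gives 1, whose projection has real part 1.\<close>

lemma quat_eq_0_iff_slice_proj: "x = 0 \<longleftrightarrow> (\<forall>w. slice_proj K (x * w) = 0)"
proof
  assume *: "\<forall>w. slice_proj K (x * w) = 0"
  show "x = 0"
  proof (rule ccontr)
    assume "x \<noteq> 0"
    then have "slice_proj K 1 = 0"
      using *[rule_format, of "inverse x"] by simp
    then show False
      by (simp add: slice_proj_def complex_eq_iff)
  qed
qed simp

lemma slice_embed_mult: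
  assumes "K \<in> imag_units"
  shows "slice_embed K (z * w) = slice_embed K z * slice_embed K w"
proof -
  have "K * K = - 1"
    using imag_units_mult_mult[OF assms, of 1] by simp
  then show ?thesis
    unfolding slice_embed_mult_left by (simp add: slice_embed_def of_real_def algebra_simps)
qed

lemma slice_embed_1 [simp]: "slice_embed K 1 = 1"
  by (simp add: slice_embed_def)

text \<open>Multiplicativity of \<open>slice_embed K\<close> keeps monomials at slice points inside
  the slice plane, so that they can be pulled out of \<open>slice_proj\<close> on the left.\<close>

lemma ord_monom_slice_embed:
  assumes "K \<in> imag_units"
  shows "ord_monom l (\<chi> i. slice_embed K (z $ i)) = slice_embed K (ord_monom l z)"
proof -
  have "slice_embed K u ^ k = slice_embed K (u ^ k)" for u k
    by (induction k) (simp_all add: slice_embed_mult[OF assms])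
  then have "prod_list (map (\<lambda>i. slice_embed K (z $ i) ^ (l $ i)) is)
      = slice_embed K (prod_list (map (\<lambda>i. (z $ i) ^ (l $ i)) is))" for "is"
    by (induction "is") (simp_all add: slice_embed_mult[OF assms])
  then show ?thesis
    by (simp add: ord_monom_def)
qed

text \<open>As f may send nonzero coefficients to 0, the mapped polynomial can have fewer keys than
  P; the additional summands vanish.\<close>

lemma ord_eval_map:
  fixes f :: "'a::semiring_1 \<Rightarrow> 'b::semiring_1" and P :: "('a, 'n::{finite,linorder}) ord_poly"
  assumes "f 0 = 0"
  shows "ord_eval (Poly_Mapping.map f P) z =
    (\<Sum>l\<in>Poly_Mapping.keys P. ord_monom l z * f (Poly_Mapping.lookup P l))"
  unfolding ord_eval_def
  by (intro sum.mono_neutral_cong_left)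
     (auto simp: in_keys_iff map.rep_eq when_def assms)

lemma slice_proj_ord_eval:
  assumes "K \<in> imag_units"
  shows "slice_proj K (ord_eval P (\<chi> i. slice_embed K (z $ i)) * w)
    = ord_eval (Poly_Mapping.map (\<lambda>a. slice_proj K (a * w)) P) z"
  by (simp add: ord_eval_map ord_eval_def[of P] sum_distrib_right slice_proj_sum mult.assoc
      ord_monom_slice_embed[OF assms] slice_proj_embed_mult[OF assms])

lemma slice_algebraic_zero_locus:
  fixes S :: "(quat, 'n::{finite,linorder}) ord_poly set"
  shows "slice_algebraic (zero_locus S)"
  unfolding slice_algebraic_def
proof
  fix K assume K: "K \<in> imag_units"
  define e where "e = (\<lambda>z :: complex ^ 'n::{finite,linorder}. \<chi> i. slice_embed K (z $ i))"
  define F where "F = {Poly_Mapping.map (\<lambda>a. slice_proj K (a * w)) P | P w. P \<in> S}"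
  have Z: "zero_locus F = {z. e z \<in> zero_locus S}"
    unfolding zero_locus_def F_def e_def
    by (auto simp: quat_eq_0_iff_slice_proj[where K = K] slice_proj_ord_eval[OF K])
  \<comment> \<open>Complex preimages are chosen coordinate by coordinate. Thus e maps onto the
    slice points, and the intersection is the image under e of its preimage.\<close>
  have "\<exists>z. q = e z" if "\<forall>i. q $ i \<in> slice_plane K" for q
    using that choice[of "\<lambda>i u. q $ i = slice_embed K u"]
    by (auto simp: slice_plane_def e_def vec_eq_iff image_iff intro: exI[of _ "vec_lambda _"])
  moreover have "e z $ i \<in> slice_plane K" for z i
    by (simp add: e_def slice_plane_def)
  ultimately have "zero_locus S \<inter> {q. \<forall>i. q $ i \<in> slice_plane K} = e ` zero_locus F"
    unfolding Z by blast
  then show "\<exists>Z. complex_algebraic Z \<and> zero_locus S \<inter> {q. \<forall>i. q $ i \<in> slice_plane K}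
      = (\<lambda>z. \<chi> i. slice_embed K (z $ i)) ` Z"
    unfolding complex_algebraic_def e_def by blast
qed

theorem theorem4p6:
  fixes I :: "(quat, 'n::{finite,linorder}) ord_poly set"
  assumes "right_ideal I"
  shows "slice_algebraic (zero_locus I)"
  by (rule slice_algebraic_zero_locus)

end
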